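(* Let $A,R,X$ be pairwise disjoint finite sets of propositional variables and let $f$ be a formula in $(A\uplus R,X)$-layered smooth decision-DNNF. Let $U(f)\in\mathbb N$ be its relaxed upper bound. Then $U(f)\ge\mathrm{emajsat}_A(f)$.
   Context: Decision-DNNF. A formula in decision-DNNF is a DAG built from the following nodes ($V(f)$ denotes the set of variables of $f$): (i) $\top$ and $\bot$, with $V(\top)=V(\bot)=\varnothing$; (ii) decomposable And nodes $\bigwedge_{i=1}^n f_i$ where the $f_i$ are in decision-DNNF and $V(f_i)\cap V(f_j)=\varnothing$ for $i\ne j$; (iii) decision nodes $\mathrm{ite}(v,g,h)$ ("if $v$ then $g$ else $h$") where $v$ is a variable, $g,h$ are in decision-DNNF, $v\notin V(g)$ and $v\notin V(h)$; $V(\mathrm{ite}(v,g,h))=\{v\}\cup V(g)\cup V(h)$. The formula is smooth if $V(g)=V(h)$ for every decision node $\mathrm{ite}(v,g,h)$. For disjoint sets $Y,Z$ of variables, it is $(Y,Z)$-layered if $V(f)\subseteq Y\uplus Z$ and, for every decision node $\mathrm{ite}(v,g,h)$, $v\in Z$ implies $V(g)\subseteq Z$ (for smooth formulas, hence also $V(h)\subseteq Z$). E-MAJSAT. With $\mathbb B=\{\top,\bot\}$ and $a\in\mathbb B^A$, $f|_a$ is $f$ with each variable $v\in A$ replaced by $a(v)$; $\sharp(f|_a)$ is its number of models, counted as valuations of $V(f)\setminus A$. Then $\mathrm{emajsat}_A(f)=\max_{a\in\mathbb B^A}\sharp(f|_a)$. Relaxed upper bound. $U$ is defined inductively by $U(\top)=1$,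 $U(\bot)=0$; $U(\mathrm{ite}(v,g,h))=U(g)+U(h)$ if $v\in X$; $U(\mathrm{ite}(v,g,h))=\max(U(g),U(h))$ if $v\in A$; $U(\mathrm{ite}(v,g,h))=U(g)+U(h)$ if $v\in R$; $U(\bigwedge_{i=1}^n g_i)=\prod_{i=1}^n U(g_i)$. *)

theory Defs
  imports Main "HOL-Library.FuncSet"
begin

(* Formulas are represented by the tree unfolding of their DAG: the variables, the models and
   the relaxed upper bound of a node depend only on its label and its children, so that sharing
   of subformulas plays no role. Decomposability and the condition on decision variables are
   imposed by the predicate decision_dnnf below. *)

datatype 'v formula =
    Top
  | Bot
  | And "'v formula list"
  | Ite 'v "'v formula" "'v formula"

primrec vars :: "'v formula \<Rightarrow> 'v set" where
  "vars Top = {}"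
| "vars Bot = {}"
| "vars (And fs) = \<Union> (set (map vars fs))"
| "vars (Ite v g h) = {v} \<union> vars g \<union> vars h"

primrec nodes :: "'v formula \<Rightarrow> 'v formula set" where
  "nodes Top = {Top}"
| "nodes Bot = {Bot}"
| "nodes (And fs) = {And fs} \<union> \<Union> (set (map nodes fs))"
| "nodes (Ite v g h) = {Ite v g h} \<union> nodes g \<union> nodes h"

inductive decision_dnnf :: "'v formula \<Rightarrow> bool" where
  Top: "decision_dnnf Top"
| Bot: "decision_dnnf Bot"
| And: "\<lbrakk>\<forall>f\<in>set fs. decision_dnnf f;
         \<forall>i<length fs. \<forall>j<length fs. i \<noteq> j \<longrightarrow> vars (fs ! i) \<inter> vars (fs ! j) = {}\<rbrakk>
        \<Longrightarrow> decision_dnnf (And fs)"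
| Ite: "\<lbrakk>decision_dnnf g; decision_dnnf h; v \<notin> vars g; v \<notin> vars h\<rbrakk>
        \<Longrightarrow> decision_dnnf (Ite v g h)"

definition smooth :: "'v formula \<Rightarrow> bool" where
  "smooth f \<longleftrightarrow> (\<forall>v g h. Ite v g h \<in> nodes f \<longrightarrow> vars g = vars h)"

definition layered :: "'v set \<Rightarrow> 'v set \<Rightarrow> 'v formula \<Rightarrow> bool" where
  "layered Y Z f \<longleftrightarrow>
     vars f \<subseteq> Y \<union> Z \<and> (\<forall>v g h. Ite v g h \<in> nodes f \<longrightarrow> v \<in> Z \<longrightarrow> vars g \<subseteq> Z)"

primrec eval :: "('v \<Rightarrow> bool) \<Rightarrow> 'v formula \<Rightarrow> bool" where
  "eval m Top = True"
| "eval m Bot = False"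
| "eval m (And fs) = list_all (\<lambda>b. b) (map (eval m) fs)"
| "eval m (Ite v g h) = (if m v then eval m g else eval m h)"

(* Replacing the variable v of a decision node by a constant turns the node into
   "if true then g else h" or "if false then g else h", i.e. into one of its two branches. *)

primrec condition :: "'v set \<Rightarrow> ('v \<Rightarrow> bool) \<Rightarrow> 'v formula \<Rightarrow> 'v formula" where
  "condition A a Top = Top"
| "condition A a Bot = Bot"
| "condition A a (And fs) = And (map (condition A a) fs)"
| "condition A a (Ite v g h) =
     (if v \<in> A then (if a v then condition A a g else condition A a h)
      else Ite v (condition A a g) (condition A a h))"

(* The valuations of a set W of variables are the extensional functions in
   W \<rightarrow>\<^sub>E UNIV, so that each of them is counted exactly once. *)

definition count_models :: "'v set \<Rightarrow> 'v formula \<Rightarrow> nat" where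
  "count_models W f = card {m \<in> W \<rightarrow>\<^sub>E (UNIV :: bool set). eval m f}"

(* The models of the conditioned formula are counted over vars f - A, which may be larger than
   the set of variables that still occur in it. *)

definition emajsat :: "'v set \<Rightarrow> 'v formula \<Rightarrow> nat" where
  "emajsat A f =
     Max ((\<lambda>a. count_models (vars f - A) (condition A a f)) ` (A \<rightarrow>\<^sub>E (UNIV :: bool set)))"

(* Variables outside A, R and X do not occur in the formulas considered; the bound is left
   unspecified for them. *)

primrec upper_bound :: "'v set \<Rightarrow> 'v set \<Rightarrow> 'v set \<Rightarrow> 'v formula \<Rightarrow> nat" where
  "upper_bound A R X Top = 1"
| "upper_bound A R X Bot = 0"
| "upper_bound A R X (And gs) = prod_list (map (upper_bound A R X) gs)"
| "upper_bound A R X (Ite v g h) =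
     (if v \<in> X then upper_bound A R X g + upper_bound A R X h
      else if v \<in> A then max (upper_bound A R X g) (upper_bound A R X h)
      else if v \<in> R then upper_bound A R X g + upper_bound A R X h
      else undefined)"

end

(* For each assignment a of A, the model count of f conditioned on a is at most the relaxed upper
   bound, by structural induction on f. Restricting a model to the variables of each conjunct
   bounds the count of a conjunction by the product of the counts, and splitting on the value
   of v bounds the count of a decision node on v outside A by the sum over its branches;
   smoothness makes both branches range over the same variables. If v is in A, conditioning
   selects one branch, which is bounded by the maximum. *)
theory Submission
  imports Defs
begin

lemma finite_vars: "finite (vars f)"
  by (induction f) auto

lemma eval_cong: "(\<And>v. v \<in> vars f \<Longrightarrow> m v = m' v) \<Longrightarrow> eval m f = eval m' f"
proof (induction f)
  case (And fs)
  have "eval m g = eval m' g" if "g \<in> set fs" for g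
    using And.IH[OF that] And.prems that by auto
  then show ?case by (auto simp: list_all_iff)
qed auto

lemma eval_restrict: "vars f \<subseteq> W \<Longrightarrow> eval (restrict m W) f = eval m f"
  by (rule eval_cong) auto

text \<open>Lets conditioned formulas be counted over \<open>vars f - A\<close>. The inclusion can
  be strict if \<open>f\<close> is not smooth, as a discarded branch may have variables of its
  own.\<close>

lemma vars_condition: "vars (condition A a f) \<subseteq> vars f - A"
  by (induction f) auto

lemma smooth_And: "smooth (And fs) \<longleftrightarrow> (\<forall>f\<in>set fs. smooth f)"
  by (auto simp: smooth_def)

lemma smooth_Ite: "smooth (Ite v g h) \<longleftrightarrow> vars g = vars h \<and> smooth g \<and> smooth h"
  by (auto simp: smooth_def)

lemma finite_models:
  "finite W \<Longrightarrow> finite {m \<in> W \<rightarrow>\<^sub>E (UNIV :: bool set). eval m f}"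
  by (simp add: finite_PiE)

text \<open>Source of injectivity in both counting lemmas below: a valuation is recovered from its
  restrictions to two sets covering its domain.\<close>

lemma extensional_eqI_restrict:
  assumes "m \<in> extensional (V \<union> W)" "m' \<in> extensional (V \<union> W)"
    and "restrict m V = restrict m' V" "restrict m W = restrict m' W"
  shows "m = m'"
proof (rule extensionalityI[OF assms(1,2)])
  fix x assume "x \<in> V \<union> W"
  then show "m x = m' x"
    using assms(3,4)[THEN fun_cong, of x] by (auto simp: restrict_def)
qed

text \<open>A model maps injectively to its pair of restrictions. Pairs that disagree on a possible
  overlap of \<open>V\<close> and \<open>W\<close> have no preimage, hence only an
  inequality.\<close>

lemma count_models_And_Cons:
  assumes "finite V" "finite W" "vars f \<subseteq> V" "vars (And fs) \<subseteq> W"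
  shows "count_models (V \<union> W) (And (f # fs)) \<le> count_models V f * count_models W (And fs)"
proof -
  let ?M = "\<lambda>U g. {m \<in> U \<rightarrow>\<^sub>E (UNIV :: bool set). eval m g}"
  let ?r = "\<lambda>m. (restrict m V, restrict m W)"
  have "card (?M (V \<union> W) (And (f # fs))) \<le> card (?M V f \<times> ?M W (And fs))"
  proof (rule card_inj_on_le)
    show "inj_on ?r (?M (V \<union> W) (And (f # fs)))"
      by (rule inj_onI, rule extensional_eqI_restrict[of _ V W]) (auto simp: PiE_def)
    have "eval (restrict m V) f \<and> eval (restrict m W) (And fs)" if "eval m (And (f # fs))" for m
      using that unfolding eval_restrict[OF assms(3)] eval_restrict[OF assms(4)] by simp
    then show "?r ` ?M (V \<union> W) (And (f # fs)) \<subseteq> ?M V f \<times> ?M W (And fs)"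
      by (auto simp del: eval.simps)
    show "finite (?M V f \<times> ?M W (And fs))"
      using assms(1,2) by (intro finite_cartesian_product finite_models)
  qed
  then show ?thesis
    by (simp add: count_models_def card_cartesian_product)
qed

text \<open>Models embed into a disjoint sum: the tag \<open>Inl\<close> or \<open>Inr\<close>
  stores the value of \<open>v\<close>, which selects the branch, and the content stores the values
  on \<open>W\<close>.\<close>

lemma count_models_Ite:
  assumes "finite W" "vars g \<subseteq> W" "vars h \<subseteq> W"
  shows "count_models (insert v W) (Ite v g h) \<le> count_models W g + count_models W h"
proof -
  let ?M = "\<lambda>U g. {m \<in> U \<rightarrow>\<^sub>E (UNIV :: bool set). eval m g}"
  let ?r = "\<lambda>m. if m v then Inl (restrict m W) else Inr (restrict m W)"
  have "card (?M (insert v W) (Ite v g h)) \<le> card (?M W g <+> ?M W h)"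
  proof (rule card_inj_on_le)
    show "inj_on ?r (?M (insert v W) (Ite v g h))"
    proof (rule inj_onI)
      fix m m'
      assume mem: "m \<in> ?M (insert v W) (Ite v g h)" "m' \<in> ?M (insert v W) (Ite v g h)"
        and eq: "?r m = ?r m'"
      have v: "m v = m' v" and W: "restrict m W = restrict m' W"
        using eq by (simp_all split: if_split_asm)
      show "m = m'"
        by (rule extensional_eqI_restrict[of _ "{v}" W])
          (use mem v W in \<open>simp_all add: PiE_def restrict_def\<close>)
    qed
    show "?r ` ?M (insert v W) (Ite v g h) \<subseteq> ?M W g <+> ?M W h"
      using eval_restrict[OF assms(2)] eval_restrict[OF assms(3)] by (auto split: if_splits)
    show "finite (?M W g <+> ?M W h)"
      using assms(1) by (intro finite_Plus finite_models)
  qed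
  then show ?thesis
    using finite_models[OF assms(1)] by (simp add: count_models_def card_Plus)
qed

lemma count_models_condition_le_upper_bound:
  assumes "A \<inter> X = {}" "smooth f" "vars f \<subseteq> A \<union> R \<union> X"
  shows "count_models (vars f - A) (condition A a f) \<le> upper_bound A R X f"
  using assms(2,3)
proof (induction f)
  case Top
  then show ?case by (simp add: count_models_def)
next
  case Bot
  then show ?case by (simp add: count_models_def)
next
  case (And fs)
  then show ?case
  \<comment> \<open>The conjuncts are split off one at a time; the induction hypotheses for all of
    them are carried along in \<open>Cons.prems\<close>.\<close>
  proof (induction fs)
    case Nil
    then show ?case by (simp add: count_models_def)
  next
    case (Cons f fs)
    have f: "count_models (vars f - A) (condition A a f) \<le> upper_bound A R X f"
      using Cons.prems by (auto simp: smooth_And)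
    have fs: "count_models (vars (And fs) - A) (condition A a (And fs)) \<le> upper_bound A R X (And fs)"
      using Cons.prems by (intro Cons.IH) (auto simp: smooth_And)
    have "vars (And (f # fs)) - A = (vars f - A) \<union> (vars (And fs) - A)"
      by auto
    then have "count_models (vars (And (f # fs)) - A) (condition A a (And (f # fs)))
        \<le> count_models (vars f - A) (condition A a f)
          * count_models (vars (And fs) - A) (condition A a (And fs))"
      using count_models_And_Cons[of "vars f - A" "vars (And fs) - A" "condition A a f"
          "map (condition A a) fs"] vars_condition[of A a f] vars_condition[of A a "And fs"]
        finite_vars[of f] finite_vars[of "And fs"]
      by (simp del: vars.simps)
    also have "\<dots> \<le> upper_bound A R X f * upper_bound A R X (And fs)"
      by (rule mult_mono[OF f fs]) auto
    finally show ?case by simp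
  qed
next
  case (Ite v g h)
  then have eq: "vars h = vars g" and
    IH: "count_models (vars g - A) (condition A a g) \<le> upper_bound A R X g"
      "count_models (vars g - A) (condition A a h) \<le> upper_bound A R X h"
    by (auto simp: smooth_Ite)
  show ?case
  proof (cases "v \<in> A")
    case True
    then show ?thesis
      \<comment> \<open>\<open>upper_bound\<close> tests \<open>X\<close> before \<open>A\<close>,
        so disjointness of \<open>A\<close> and \<open>X\<close> is what leads to its
        \<open>max\<close> case.\<close>
      using IH eq assms(1) by (auto simp: le_max_iff_disj)
  next
    case False
    have "vars (Ite v g h) - A = insert v (vars g - A)"
      using False eq by auto
    then have "count_models (vars (Ite v g h) - A) (condition A a (Ite v g h))
        \<le> count_models (vars g - A) (condition A a g) + count_models (vars g - A) (condition A a h)"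
      using False count_models_Ite[of "vars g - A" "condition A a g" "condition A a h" v]
        vars_condition[of A a g] vars_condition[of A a h] finite_vars[of g] eq
      by (simp del: vars.simps)
    also have "\<dots> \<le> upper_bound A R X g + upper_bound A R X h"
      using IH by simp
    finally show ?thesis
      \<comment> \<open>Here \<open>v\<close> lies in \<open>R\<close> or \<open>X\<close>; both
        cases of \<open>upper_bound\<close> give the sum, and \<open>undefined\<close> cannot
        occur.\<close>
      using False Ite.prems by auto
  qed
qed

theorem proposition7p8:
  fixes A R X :: "'v set" and f :: "'v formula"
  assumes "finite A" and "finite R" and "finite X"
    and "A \<inter> R = {}" and "A \<inter> X = {}" and "R \<inter> X = {}"
    and "decision_dnnf f" and "smooth f" and "layered (A \<union> R) X f"
  shows "upper_bound A R X f \<ge> emajsat A f"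
proof -
  \<comment> \<open>\<open>Max\<close> is a genuine maximum only on a finite nonempty set.\<close>
  have "finite (A \<rightarrow>\<^sub>E (UNIV :: bool set))" "A \<rightarrow>\<^sub>E (UNIV :: bool set) \<noteq> {}"
    using assms(1) by (auto simp: finite_PiE PiE_eq_empty_iff)
  moreover have "count_models (vars f - A) (condition A a f) \<le> upper_bound A R X f" for a
    using assms(5,8,9) by (intro count_models_condition_le_upper_bound) (auto simp: layered_def)
  ultimately show ?thesis
    unfolding emajsat_def by (subst Max_le_iff) auto
qed

end
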